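(* Let $(S,\cdot)$ and $(T,\cdot)$ be left amenable semigroups, let $A\subseteq S$, and let $B\subseteq T$. Then $d^*(A\times B)=d^*(A)d^*(B)$, where $S\times T$ carries the coordinatewise operation.
   Context: For a semigroup $S$, a mean on $S$ is a continuous linear functional $\mu$ on $l_\infty(S)$ (bounded real functions with the sup norm) with $\|\mu\|=1$ and $\mu(g)\ge0$ whenever $g\ge0$; it is left invariant if $\mu(g\circ\lambda_s)=\mu(g)$ for all $s\in S$, $g\in l_\infty(S)$, where $\lambda_s(y)=sy$. $LIM(S)$ is the set of left invariant means; $S$ is left amenable if $LIM(S)\ne\emptyset$. For $A\subseteq S$, the Banach density is $d^*(A)=\sup\{\lambda(\chi_A):\lambda\in LIM(S)\}$. *)

theory Defs
  imports "HOL-Analysis.Analysis" "HOL-Probability.Discrete_Topology"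
begin

text \<open>
  Every function on a discrete space is continuous, so the bounded continuous functions on
  \<open>'a discrete\<close> are all bounded functions on \<open>'a\<close>, and their library norm is the sup norm.
\<close>

type_synonym 'a linf = "'a discrete \<Rightarrow>\<^sub>C real"

lemma continuous_on_discrete_type: "continuous_on S (f :: 'a discrete \<Rightarrow> 'b::topological_space)"
proof -
  have "continuous_on UNIV f"
    unfolding continuous_on_open_vimage[OF open_UNIV] by (intro allI impI open_discrete)
  then show ?thesis
    by (rule continuous_on_subset) (rule subset_UNIV)
qed

definition mean :: "('a linf \<Rightarrow>\<^sub>L real) \<Rightarrow> bool"
  where "mean \<mu> \<longleftrightarrow> norm \<mu> = 1 \<and> (\<forall>g. (\<forall>x. 0 \<le> apply_bcontfun g x) \<longrightarrow> 0 \<le> blinfun_apply \<mu> g)"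

text \<open>\<open>left_translate s g\<close> is \<open>g \<circ> \<lambda>\<^sub>s\<close>, where \<open>\<lambda>\<^sub>s y = s * y\<close>.\<close>

definition left_translate :: "'a::semigroup_mult \<Rightarrow> 'a linf \<Rightarrow> 'a linf"
  where "left_translate s g = Bcontfun (\<lambda>y. apply_bcontfun g (discrete (s * of_discrete y)))"

lemma apply_left_translate [simp]:
  "apply_bcontfun (left_translate s g) y = apply_bcontfun g (discrete (s * of_discrete y))"
proof -
  have "bounded (range (\<lambda>y. apply_bcontfun g (discrete (s * of_discrete y))))"
    by (rule bounded_subset[OF bounded_apply_bcontfun[of g]]) (intro image_subsetI rangeI)
  then have "(\<lambda>y. apply_bcontfun g (discrete (s * of_discrete y))) \<in> bcontfun"
    by (simp add: bcontfun_def continuous_on_discrete_type)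
  then show ?thesis
    by (simp add: left_translate_def Bcontfun_inverse)
qed

definition left_invariant_means :: "('a::semigroup_mult linf \<Rightarrow>\<^sub>L real) set"
  where "left_invariant_means = {\<mu>. mean \<mu> \<and> (\<forall>s g. blinfun_apply \<mu> (left_translate s g) = blinfun_apply \<mu> g)}"

definition left_amenable :: "'a::semigroup_mult itself \<Rightarrow> bool"
  where "left_amenable _ \<longleftrightarrow> (left_invariant_means :: ('a linf \<Rightarrow>\<^sub>L real) set) \<noteq> {}"

definition char_linf :: "'a set \<Rightarrow> 'a linf"
  where "char_linf A = Bcontfun (\<lambda>x. indicator A (of_discrete x))"

lemma apply_char_linf [simp]: "apply_bcontfun (char_linf A) x = indicator A (of_discrete x)"
proof -
  have "bounded (range (\<lambda>x. indicator A (of_discrete x) :: real))"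
    by (rule boundedI[where B = 1]) (auto simp: indicator_def)
  then have "(\<lambda>x. indicator A (of_discrete x) :: real) \<in> bcontfun"
    by (simp add: bcontfun_def continuous_on_discrete_type)
  then show ?thesis
    by (simp add: char_linf_def Bcontfun_inverse)
qed

text \<open>
  The supremum is over a subset of the unit interval, which is nonempty exactly when the
  semigroup is left amenable; otherwise the value carries no meaning.
\<close>

definition banach_density :: "'a::semigroup_mult set \<Rightarrow> real"
  where "banach_density A = (SUP \<mu>\<in>left_invariant_means. blinfun_apply \<mu> (char_linf A))"

instantiation prod :: (semigroup_mult, semigroup_mult) semigroup_mult
begin

definition times_prod :: "'a \<times> 'b \<Rightarrow> 'a \<times> 'b \<Rightarrow> 'a \<times> 'b"
  where "times_prod p q = (fst p * fst q, snd p * snd q)"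

instance
  by standard (simp add: times_prod_def mult.assoc)

end

end

theory Submission
  imports Defs
begin

text \<open>
  Iterating a left invariant mean on \<open>S\<close> over one on \<open>T\<close> gives a left invariant mean on \<open>S \<times> T\<close>
  that multiplies indicators of rectangles, whence \<open>d\<^sup>*(A \<times> B) \<ge> d\<^sup>*(A) d\<^sup>*(B)\<close>. Conversely, a left
  invariant mean \<open>\<nu>\<close> on \<open>S \<times> T\<close> is invariant under translation in one coordinate only, although
  the semigroups need not have identities. Hence \<open>f \<mapsto> \<nu>(f \<otimes> \<chi>\<^sub>B)\<close> is a positive left invariant
  functional on \<open>S\<close> of total mass \<open>\<nu>(1 \<otimes> \<chi>\<^sub>B)\<close>, so \<open>\<nu>(A \<times> B) \<le> d\<^sup>*(A) \<nu>(1 \<otimes> \<chi>\<^sub>B)\<close>; and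
  \<open>g \<mapsto> \<nu>(1 \<otimes> g)\<close> is a left invariant mean on \<open>T\<close>, so \<open>\<nu>(1 \<otimes> \<chi>\<^sub>B) \<le> d\<^sup>*(B)\<close>.
\<close>

section \<open>Bounded functions, positive functionals and means\<close>

lemma apply_Bcontfun_discrete:
  fixes f :: "'a discrete \<Rightarrow> real"
  assumes "\<And>x. \<bar>f x\<bar> \<le> C"
  shows "apply_bcontfun (Bcontfun f) x = f x"
proof -
  have "bounded (range f)"
    by (rule boundedI[where B = C]) (use assms in auto)
  then have "f \<in> bcontfun"
    by (simp add: bcontfun_def continuous_on_discrete_type)
  then show ?thesis
    by (simp add: Bcontfun_inverse)
qed

lemma abs_apply_bcontfun_le: "\<bar>apply_bcontfun g x\<bar> \<le> norm (g :: 'a linf)"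
  using norm_bounded[of g x] by simp

abbreviation one_linf :: "'a linf"
  where "one_linf \<equiv> char_linf UNIV"

text \<open>Stated for plain functions rather than bounded linear ones, so that continuity can be
  deduced from positivity and linearity.\<close>

definition positive :: "('a linf \<Rightarrow> real) \<Rightarrow> bool"
  where "positive F \<longleftrightarrow> (\<forall>g. (\<forall>x. 0 \<le> apply_bcontfun g x) \<longrightarrow> 0 \<le> F g)"

lemma positiveD: "positive F \<Longrightarrow> (\<And>x. 0 \<le> apply_bcontfun g x) \<Longrightarrow> 0 \<le> F g"
  by (simp add: positive_def)

lemma positive_mono:
  assumes "linear F" "positive F" "\<And>x. apply_bcontfun f x \<le> apply_bcontfun g x"
  shows "F f \<le> F g"
  using positiveD[OF assms(2), of "g - f"] assms(3) by (simp add: linear_diff[OF assms(1)])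

text \<open>\<open>g\<close> lies between the constants \<open>- norm g\<close> and
  \<open>norm g\<close>, so monotonicity gives the bound.\<close>

lemma positive_bound:
  assumes "linear F" "positive F"
  shows "\<bar>F g\<bar> \<le> F one_linf * norm g"
proof -
  have "F g \<le> F (norm g *\<^sub>R one_linf)" "F (- norm g *\<^sub>R one_linf) \<le> F g"
    using abs_apply_bcontfun_le[of g]
    by (auto intro!: positive_mono[OF assms] simp: abs_le_iff minus_le_iff)
  then show ?thesis
    by (simp add: linear_scale[OF assms(1)] linear_neg[OF assms(1)] mult.commute abs_le_iff)
qed

lemma norm_one_linf_le: "norm (one_linf :: 'a linf) \<le> 1"
  by (rule norm_bound) simp

text \<open>By \<open>positive_bound\<close>, the norm of a positive functional is its value at the
  constant 1, so normalisation becomes a single evaluation.\<close>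

lemma mean_iff: "mean \<mu> \<longleftrightarrow> positive (blinfun_apply \<mu>) \<and> blinfun_apply \<mu> one_linf = 1"
proof -
  have "norm \<mu> = blinfun_apply \<mu> one_linf" if pos: "positive (blinfun_apply \<mu>)"
  proof (rule antisym)
    have lin: "linear (blinfun_apply \<mu>)"
      by (simp add: blinfun.bounded_linear_right bounded_linear.linear)
    show "norm \<mu> \<le> blinfun_apply \<mu> one_linf"
      using positive_bound[OF lin pos] positiveD[OF pos, of one_linf]
      by (intro norm_blinfun_bound) auto
    have "blinfun_apply \<mu> one_linf \<le> norm \<mu> * norm (one_linf :: 'a linf)"
      using norm_blinfun[of \<mu> one_linf] by simp
    also have "\<dots> \<le> norm \<mu>"
      by (intro mult_left_le norm_one_linf_le norm_ge_zero)
    finally show "blinfun_apply \<mu> one_linf \<le> norm \<mu>" .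
  qed
  then show ?thesis
    by (auto simp: mean_def positive_def)
qed

text \<open>Continuity comes from \<open>positive_bound\<close>, so a mean can be built from a plain
  linear function.\<close>

lemma left_invariant_meansI:
  fixes F :: "'a::semigroup_mult linf \<Rightarrow> real"
  assumes "linear F" "positive F" "F one_linf = 1" "\<And>s g. F (left_translate s g) = F g"
  shows "Blinfun F \<in> left_invariant_means" and "blinfun_apply (Blinfun F) = F"
proof -
  have "bounded_linear F"
    using positive_bound[OF assms(1,2)] assms(1)
    by (intro bounded_linear_intro[where K = 1])
      (auto simp: linear_add linear_scale assms(3))
  then show "blinfun_apply (Blinfun F) = F"
    by (simp add: bounded_linear_Blinfun_apply)
  then show "Blinfun F \<in> left_invariant_means"
    using assms by (simp add: left_invariant_means_def mean_iff)
qed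

lemma left_invariant_meansD:
  assumes "\<mu> \<in> left_invariant_means"
  shows "linear (blinfun_apply \<mu>)" "positive (blinfun_apply \<mu>)" "blinfun_apply \<mu> one_linf = 1"
    "blinfun_apply \<mu> (left_translate s g) = blinfun_apply \<mu> g"
  using assms by (auto simp: left_invariant_means_def mean_iff blinfun.bounded_linear_right
      bounded_linear.linear)

lemma char_linf_bounds:
  assumes "\<mu> \<in> left_invariant_means"
  shows "0 \<le> blinfun_apply \<mu> (char_linf A)" "blinfun_apply \<mu> (char_linf A) \<le> 1"
proof -
  note \<mu> = left_invariant_meansD[OF assms]
  show "0 \<le> blinfun_apply \<mu> (char_linf A)"
    by (rule positiveD[OF \<mu>(2)]) simp
  have "blinfun_apply \<mu> (char_linf A) \<le> blinfun_apply \<mu> one_linf"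
    by (rule positive_mono[OF \<mu>(1,2)]) (simp add: indicator_def)
  then show "blinfun_apply \<mu> (char_linf A) \<le> 1"
    using \<mu>(3) by simp
qed

section \<open>Bounds for the Banach density\<close>

lemma banach_density_upper:
  assumes "\<mu> \<in> left_invariant_means"
  shows "blinfun_apply \<mu> (char_linf A) \<le> banach_density A"
  unfolding banach_density_def
  \<comment> \<open>A real supremum is known to dominate its members once they are bounded above,
    here by 1.\<close>
  by (rule cSUP_upper[OF assms]) (auto intro!: bdd_aboveI[where M = 1] char_linf_bounds)

lemma banach_density_le:
  fixes A :: "'a::semigroup_mult set"
  assumes "left_amenable TYPE('a)"
    and "\<And>\<mu>. \<mu> \<in> left_invariant_means \<Longrightarrow> blinfun_apply \<mu> (char_linf A) \<le> c"
  shows "banach_density A \<le> c"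
  unfolding banach_density_def
  using assms by (intro cSUP_least) (auto simp: left_amenable_def)

lemma banach_density_nonneg:
  fixes A :: "'a::semigroup_mult set"
  assumes "left_amenable TYPE('a)"
  shows "0 \<le> banach_density A"
proof -
  obtain \<mu> :: "'a linf \<Rightarrow>\<^sub>L real" where "\<mu> \<in> left_invariant_means"
    using assms by (auto simp: left_amenable_def)
  then show ?thesis
    using char_linf_bounds(1) banach_density_upper by (blast intro: order_trans)
qed

text \<open>Dividing by the total mass \<open>F one_linf\<close> yields a left invariant mean. This
  serves for functionals got by fixing one factor of a product, whose mass need not be 1.\<close>

lemma positive_invariant_le_banach_density:
  fixes F :: "'a::semigroup_mult linf \<Rightarrow> real"
  assumes lin: "linear F" and pos: "positive F"
    and inv: "\<And>s g. F (left_translate s g) = F g"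
  shows "F (char_linf A) \<le> banach_density A * F one_linf"
proof (cases "F one_linf = 0")
  \<comment> \<open>Normalising is impossible here, but \<open>positive_bound\<close> forces
    \<open>F\<close> to vanish.\<close>
  case True
  then show ?thesis
    using positive_bound[OF lin pos, of "char_linf A"] by simp
next
  case False
  then have c: "F one_linf > 0"
    using positiveD[OF pos, of one_linf] by simp
  define G where "G = (\<lambda>g. F g / F one_linf)"
  have "linear G"
    unfolding G_def using lin
    by (intro linearI) (auto simp: linear_add linear_scale add_divide_distrib)
  moreover have "positive G"
    using pos c by (simp add: G_def positive_def)
  moreover have "G one_linf = 1" and "\<And>s g. G (left_translate s g) = G g"
    using c inv by (simp_all add: G_def)
  ultimately have "G (char_linf A) \<le> banach_density A"
    using left_invariant_meansI[of G] banach_density_upper[of "Blinfun G" A] by simp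
  then show ?thesis
    using c by (simp add: G_def pos_divide_le_eq)
qed

section \<open>Iterated means on the product\<close>

definition linf_slice :: "('a \<times> 'b) linf \<Rightarrow> 'a \<Rightarrow> 'b linf"
  where "linf_slice f x = Bcontfun (\<lambda>y. apply_bcontfun f (discrete (x, of_discrete y)))"

lemma apply_linf_slice [simp]:
  "apply_bcontfun (linf_slice f x) y = apply_bcontfun f (discrete (x, of_discrete y))"
  unfolding linf_slice_def by (rule apply_Bcontfun_discrete) (rule abs_apply_bcontfun_le)

lemma norm_linf_slice_le: "norm (linf_slice f x) \<le> norm f"
  by (rule norm_bound) (simp add: abs_apply_bcontfun_le)

definition linf_integrate :: "('b linf \<Rightarrow>\<^sub>L real) \<Rightarrow> ('a \<times> 'b) linf \<Rightarrow> 'a linf"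
  where "linf_integrate \<mu> f = Bcontfun (\<lambda>x. blinfun_apply \<mu> (linf_slice f (of_discrete x)))"

lemma apply_linf_integrate [simp]:
  "apply_bcontfun (linf_integrate \<mu> f) x = blinfun_apply \<mu> (linf_slice f (of_discrete x))"
  unfolding linf_integrate_def
proof (rule apply_Bcontfun_discrete)
  fix x :: "'a discrete"
  have "\<bar>blinfun_apply \<mu> (linf_slice f (of_discrete x))\<bar> \<le> norm \<mu> * norm (linf_slice f (of_discrete x))"
    using norm_blinfun[of \<mu>] by simp
  also have "\<dots> \<le> norm \<mu> * norm f"
    by (rule mult_left_mono[OF norm_linf_slice_le]) simp
  finally show "\<bar>blinfun_apply \<mu> (linf_slice f (of_discrete x))\<bar> \<le> norm \<mu> * norm f" .
qed

text \<open>The slice of the rectangle at \<open>x\<close> is the indicator of \<open>B\<close> if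
  \<open>x\<close> lies in \<open>A\<close>, and zero otherwise.\<close>

lemma linf_integrate_char_Times:
  "linf_integrate \<mu> (char_linf (A \<times> B)) = blinfun_apply \<mu> (char_linf B) *\<^sub>R char_linf A"
proof (rule bcontfun_eqI)
  fix x
  have "linf_slice (char_linf (A \<times> B)) (of_discrete x) =
      indicator A (of_discrete x) *\<^sub>R (char_linf B)"
    by (rule bcontfun_eqI) (simp add: indicator_def of_discrete_inverse discrete_inverse)
  then show "apply_bcontfun (linf_integrate \<mu> (char_linf (A \<times> B))) x =
      apply_bcontfun (blinfun_apply \<mu> (char_linf B) *\<^sub>R char_linf A) x"
    by (simp add: blinfun.scaleR_right)
qed

lemma product_left_invariant_mean:
  fixes l :: "'s::semigroup_mult linf \<Rightarrow>\<^sub>L real" and m :: "'t::semigroup_mult linf \<Rightarrow>\<^sub>L real"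
  assumes "l \<in> left_invariant_means" "m \<in> left_invariant_means"
  obtains \<nu> :: "('s \<times> 't) linf \<Rightarrow>\<^sub>L real" where "\<nu> \<in> left_invariant_means"
    "\<And>A B. blinfun_apply \<nu> (char_linf (A \<times> B)) =
      blinfun_apply l (char_linf A) * blinfun_apply m (char_linf B)"
proof -
  note l = left_invariant_meansD[OF assms(1)] and m = left_invariant_meansD[OF assms(2)]
  define F where "F = (\<lambda>f. blinfun_apply l (linf_integrate m f))"
  have rect: "F (char_linf (A \<times> B)) = blinfun_apply l (char_linf A) * blinfun_apply m (char_linf B)"
    for A B
    by (simp add: F_def linf_integrate_char_Times blinfun.scaleR_right)
  have "linear F"
  proof (rule linearI)
    fix f g :: "('s \<times> 't) linf" and c :: real
    have "linf_slice (f + g) x = linf_slice f x + linf_slice g x" for x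
      by (rule bcontfun_eqI) simp
    then have "linf_integrate m (f + g) = linf_integrate m f + linf_integrate m g"
      by (intro bcontfun_eqI) (simp add: blinfun.add_right)
    then show "F (f + g) = F f + F g"
      by (simp add: F_def blinfun.add_right)
    have "linf_slice (c *\<^sub>R f) x = c *\<^sub>R linf_slice f x" for x
      by (rule bcontfun_eqI) simp
    then have "linf_integrate m (c *\<^sub>R f) = c *\<^sub>R linf_integrate m f"
      by (intro bcontfun_eqI) (simp add: blinfun.scaleR_right)
    then show "F (c *\<^sub>R f) = c *\<^sub>R F f"
      by (simp add: F_def blinfun.scaleR_right)
  qed
  moreover have "positive F"
    unfolding positive_def F_def
    by (intro allI impI positiveD[OF l(2)]) (auto intro!: positiveD[OF m(2)])
  moreover have "F one_linf = 1"
    using rect[of UNIV UNIV] l(3) m(3) by simp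
  moreover have "F (left_translate p f) = F f" for p f
  proof -
    \<comment> \<open>Both sides send \<open>y\<close> to \<open>f (fst p * x, snd p * y)\<close>.
      Invariance of \<open>m\<close> removes \<open>snd p\<close>, then that of \<open>l\<close>
      removes \<open>fst p\<close>.\<close>
    have "linf_slice (left_translate p f) x = left_translate (snd p) (linf_slice f (fst p * x))" for x
      by (rule bcontfun_eqI) (simp add: times_prod_def discrete_inverse)
    then have "linf_integrate m (left_translate p f) = left_translate (fst p) (linf_integrate m f)"
      by (intro bcontfun_eqI) (simp add: m(4) discrete_inverse)
    then show ?thesis
      by (simp add: F_def l(4))
  qed
  ultimately have "Blinfun F \<in> left_invariant_means" "blinfun_apply (Blinfun F) = F"
    using left_invariant_meansI[of F] by blast+
  then show thesis
    using that[of "Blinfun F"] rect by simp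
qed

section \<open>Tensor products and translation in one coordinate\<close>

definition linf_tensor :: "'a linf \<Rightarrow> 'b linf \<Rightarrow> ('a \<times> 'b) linf"
  where "linf_tensor f g = Bcontfun (\<lambda>p. apply_bcontfun f (discrete (fst (of_discrete p))) *
    apply_bcontfun g (discrete (snd (of_discrete p))))"

lemma apply_linf_tensor [simp]:
  "apply_bcontfun (linf_tensor f g) p = apply_bcontfun f (discrete (fst (of_discrete p))) *
    apply_bcontfun g (discrete (snd (of_discrete p)))"
  unfolding linf_tensor_def
  by (rule apply_Bcontfun_discrete[where C = "norm f * norm g"])
    (simp add: abs_mult mult_mono abs_apply_bcontfun_le)

lemma linear_linf_tensor_left: "linear (\<lambda>f. linf_tensor f g)"
  by (intro linearI bcontfun_eqI) (simp_all add: distrib_right)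

lemma linear_linf_tensor_right: "linear (linf_tensor f)"
  by (intro linearI bcontfun_eqI) (simp_all add: distrib_left)

lemma linf_tensor_char: "linf_tensor (char_linf A) (char_linf B) = char_linf (A \<times> B)"
  by (rule bcontfun_eqI) (simp add: indicator_def discrete_inverse mem_Times_iff)

text \<open>
  A translation in one coordinate alone becomes a translation of the product semigroup once it is
  followed by a further translation in both coordinates.
\<close>

lemma tensor_left_translate:
  fixes f :: "'s::semigroup_mult linf" and g :: "'t::semigroup_mult linf"
  assumes "\<nu> \<in> left_invariant_means"
  shows "blinfun_apply \<nu> (linf_tensor (left_translate s f) g) = blinfun_apply \<nu> (linf_tensor f g)"
    and "blinfun_apply \<nu> (linf_tensor f (left_translate t g)) = blinfun_apply \<nu> (linf_tensor f g)"
proof -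
  note inv = left_invariant_meansD(4)[OF assms]
  \<comment> \<open>Both sides send \<open>(x, y)\<close> to
    \<open>f (s * s * x) * g (t * y)\<close>; the arbitrary \<open>t\<close> stands in for an
    identity.\<close>
  have "left_translate (s, t) (linf_tensor (left_translate s f) g) =
      left_translate (s * s, t) (linf_tensor f g)"
    by (rule bcontfun_eqI) (simp add: times_prod_def discrete_inverse mult.assoc)
  then show "blinfun_apply \<nu> (linf_tensor (left_translate s f) g) = blinfun_apply \<nu> (linf_tensor f g)"
    by (metis inv)
  have "left_translate (s, t) (linf_tensor f (left_translate t g)) =
      left_translate (s, t * t) (linf_tensor f g)"
    by (rule bcontfun_eqI) (simp add: times_prod_def discrete_inverse mult.assoc)
  then show "blinfun_apply \<nu> (linf_tensor f (left_translate t g)) = blinfun_apply \<nu> (linf_tensor f g)"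
    by (metis inv)
qed

text \<open>The estimate for a single semigroup is applied twice: first with
  \<open>char_linf B\<close> fixed, then to the mass this leaves, with the constant 1 fixed. The
  last mass is \<nu>(1) = 1.\<close>

lemma char_Times_le_banach_density_mult:
  fixes A :: "'s::semigroup_mult set" and B :: "'t::semigroup_mult set"
  assumes "left_amenable TYPE('s)" "\<nu> \<in> left_invariant_means"
  shows "blinfun_apply \<nu> (char_linf (A \<times> B)) \<le> banach_density A * banach_density B"
proof -
  note \<nu> = left_invariant_meansD[OF assms(2)]
  have "blinfun_apply \<nu> (linf_tensor (char_linf A) (char_linf B)) \<le>
      banach_density A * blinfun_apply \<nu> (linf_tensor one_linf (char_linf B))"
  proof (rule positive_invariant_le_banach_density)
    show "linear (\<lambda>f. blinfun_apply \<nu> (linf_tensor f (char_linf B)))"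
      using linear_compose[OF linear_linf_tensor_left \<nu>(1)] by (simp add: o_def)
    show "positive (\<lambda>f. blinfun_apply \<nu> (linf_tensor f (char_linf B)))"
      unfolding positive_def by (auto intro!: positiveD[OF \<nu>(2)])
  qed (rule tensor_left_translate[OF assms(2)])
  also have "\<dots> \<le> banach_density A * banach_density B"
  proof (rule mult_left_mono)
    have "blinfun_apply \<nu> (linf_tensor one_linf (char_linf B)) \<le>
        banach_density B * blinfun_apply \<nu> (linf_tensor one_linf one_linf)"
    proof (rule positive_invariant_le_banach_density)
      show "linear (\<lambda>g. blinfun_apply \<nu> (linf_tensor one_linf g))"
        using linear_compose[OF linear_linf_tensor_right \<nu>(1)] by (simp add: o_def)
      show "positive (\<lambda>g. blinfun_apply \<nu> (linf_tensor one_linf g))"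
        unfolding positive_def by (auto intro!: positiveD[OF \<nu>(2)])
    qed (rule tensor_left_translate[OF assms(2)])
    then show "blinfun_apply \<nu> (linf_tensor one_linf (char_linf B)) \<le> banach_density B"
      by (simp add: linf_tensor_char \<nu>(3))
  qed (rule banach_density_nonneg[OF assms(1)])
  finally show ?thesis
    by (simp add: linf_tensor_char)
qed

theorem theorem6p2:
  fixes A :: "'s::semigroup_mult set" and B :: "'t::semigroup_mult set"
  assumes "left_amenable TYPE('s)" and "left_amenable TYPE('t)"
  shows "banach_density (A \<times> B) = banach_density A * banach_density B"
proof (rule antisym)
  have rect_le: "blinfun_apply l (char_linf A) * blinfun_apply m (char_linf B) \<le> banach_density (A \<times> B)"
    if "l \<in> left_invariant_means" "m \<in> left_invariant_means" for l m
    using product_left_invariant_mean[OF that] banach_density_upper by metis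
  \<comment> \<open>An iterated mean makes the supremum defining the density on the product range
    over a nonempty set.\<close>
  have amenable: "left_amenable TYPE('s \<times> 't)"
    using assms product_left_invariant_mean unfolding left_amenable_def by blast
  show "banach_density (A \<times> B) \<le> banach_density A * banach_density B"
    by (rule banach_density_le[OF amenable]) (rule char_Times_le_banach_density_mult[OF assms(1)])
  \<comment> \<open>Supremum of \<open>rect_le\<close> over \<open>l\<close> for fixed
    \<open>m\<close>, taken after division by \<open>m (char_linf B)\<close> unless that value is
    0.\<close>
  have step: "banach_density A * blinfun_apply m (char_linf B) \<le> banach_density (A \<times> B)"
    if m: "m \<in> left_invariant_means" for m :: "'t linf \<Rightarrow>\<^sub>L real"
  proof (cases "blinfun_apply m (char_linf B) = 0")
    case True
    then show ?thesis
      using banach_density_nonneg[OF amenable] by simp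
  next
    case False
    then have pos: "blinfun_apply m (char_linf B) > 0"
      using char_linf_bounds(1)[OF m, of B] by simp
    then have "banach_density A \<le> banach_density (A \<times> B) / blinfun_apply m (char_linf B)"
      using rect_le m by (intro banach_density_le[OF assms(1)]) (simp add: pos_le_divide_eq)
    then show ?thesis
      using pos by (simp add: pos_le_divide_eq)
  qed
  show "banach_density A * banach_density B \<le> banach_density (A \<times> B)"
  \<comment> \<open>Supremum of \<open>step\<close> over \<open>m\<close>, now after division by
    \<open>banach_density A\<close>.\<close>
  proof (cases "banach_density A = 0")
    case True
    then show ?thesis
      using banach_density_nonneg[OF amenable] by simp
  next
    case False
    then have pos: "banach_density A > 0"
      using banach_density_nonneg[OF assms(1), of A] by simp
    then have "banach_density B \<le> banach_density (A \<times> B) / banach_density A"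
      using step by (intro banach_density_le[OF assms(2)]) (simp add: pos_le_divide_eq mult.commute)
    then show ?thesis
      using pos by (simp add: pos_le_divide_eq mult.commute)
  qed
qed

end
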